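(* Let $\lambda=\{\lambda_v\}_{v\in V}$ be a system of weights on a directed forest $\mathcal T=(V,p)$. Then the (not necessarily bounded) weighted shift $S_\lambda$ on $\mathcal T$ is unitarily equivalent to the weighted shift $S_{|\lambda|}$ on the same forest, where $|\lambda|:=\{|\lambda_v|\}_{v\in V}$.
   Context: A directed forest is a pair $\mathcal T=(V,p)$ where $V$ is a nonempty set and $p:V\to V$ is a function such that $p^n(v)=v$ with $n\ge 1$ implies $p(v)=v$. Roots are the $v\in V$ with $p(v)=v$. A system of weights on $\mathcal T$ is $\lambda=\{\lambda_v\}_{v\in V}\subseteq\mathbb C$ with $\lambda_v=0$ for every root $v$. The weighted shift $S_\lambda$ on $\mathcal T$ is the operator in the complex Hilbert space $\ell^2(V)$ of square-summable functions on $V$ defined as follows: let $\tilde S:\mathbb C^V\to\mathbb C^V$, $\tilde S(f)(v)=\lambda_v f(p(v))$; the domain is $\mathscr D(S_\lambda)=\{f\in\ell^2(V):\tilde S(f)\in\ell^2(V)\}$, and $S_\lambda f=\tilde S(f)$ for $f\in\mathscr D(S_\lambda)$. Two (possibly unbounded) operators $A,B$ in $\ell^2(V)$ are unitarily equivalent if $B=UAU^*$ for some unitary $U$ on $\ell^2(V)$ (including equality of domains). *)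

theory Defs
  imports "HOL-Analysis.Analysis"
begin

section \<open>Directed forests and systems of weights\<close>

definition directed_forest :: "'v set \<Rightarrow> ('v \<Rightarrow> 'v) \<Rightarrow> bool" where
  "directed_forest V p \<longleftrightarrow>
     V \<noteq> {} \<and> p ` V \<subseteq> V \<and>
     (\<forall>v\<in>V. \<forall>n\<ge>1. (p ^^ n) v = v \<longrightarrow> p v = v)"

definition forest_roots :: "'v set \<Rightarrow> ('v \<Rightarrow> 'v) \<Rightarrow> 'v set" where
  "forest_roots V p = {v \<in> V. p v = v}"

text \<open>Only the values of \<open>lam\<close> on \<open>V\<close> matter here and below.\<close>

definition weight_system :: "'v set \<Rightarrow> ('v \<Rightarrow> 'v) \<Rightarrow> ('v \<Rightarrow> complex) \<Rightarrow> bool" where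
  "weight_system V p lam \<longleftrightarrow> (\<forall>v \<in> forest_roots V p. lam v = 0)"

section \<open>The Hilbert space of square-summable functions\<close>

text \<open>A function \<open>V \<rightarrow> \<complex>\<close> is represented by its extension by zero to the whole type, so that
  equality of functions on \<open>V\<close> is equality in HOL and the vector space operations are pointwise.\<close>

definition ell2 :: "'v set \<Rightarrow> ('v \<Rightarrow> complex) set" where
  "ell2 V = {f. (\<forall>v. v \<notin> V \<longrightarrow> f v = 0) \<and> (\<lambda>v. (cmod (f v))\<^sup>2) summable_on V}"

definition ell2_inner :: "'v set \<Rightarrow> ('v \<Rightarrow> complex) \<Rightarrow> ('v \<Rightarrow> complex) \<Rightarrow> complex" where
  "ell2_inner V f g = (\<Sum>\<^sub>\<infinity>v\<in>V. f v * cnj (g v))"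

section \<open>Unitary equivalence of not necessarily bounded operators\<close>

text \<open>An operator in \<open>ell2 V\<close> is a partial function whose \<open>dom\<close> is its domain. Equality of
  partial functions therefore includes equality of domains.\<close>

type_synonym 'v operator = "('v \<Rightarrow> complex) \<rightharpoonup> ('v \<Rightarrow> complex)"

text \<open>In contrast, the everywhere defined operators \<open>U\<close> and \<open>Ustar\<close> below are total functions
  whose values outside \<open>ell2 V\<close> are irrelevant.\<close>

definition unitary_on :: "'v set \<Rightarrow> (('v \<Rightarrow> complex) \<Rightarrow> ('v \<Rightarrow> complex)) \<Rightarrow> bool" where
  "unitary_on V U \<longleftrightarrow>
     bij_betw U (ell2 V) (ell2 V) \<and>
     (\<forall>f\<in>ell2 V. \<forall>g\<in>ell2 V. U (\<lambda>v. f v + g v) = (\<lambda>v. U f v + U g v)) \<and>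
     (\<forall>c. \<forall>f\<in>ell2 V. U (\<lambda>v. c * f v) = (\<lambda>v. c * U f v)) \<and>
     (\<forall>f\<in>ell2 V. \<forall>g\<in>ell2 V. ell2_inner V (U f) (U g) = ell2_inner V f g)"

definition adjoint_on ::
    "'v set \<Rightarrow> (('v \<Rightarrow> complex) \<Rightarrow> ('v \<Rightarrow> complex)) \<Rightarrow> (('v \<Rightarrow> complex) \<Rightarrow> ('v \<Rightarrow> complex)) \<Rightarrow> bool" where
  "adjoint_on V U Ustar \<longleftrightarrow>
     Ustar ` ell2 V \<subseteq> ell2 V \<and>
     (\<forall>f\<in>ell2 V. \<forall>g\<in>ell2 V. ell2_inner V (U f) g = ell2_inner V f (Ustar g))"

text \<open>The product \<open>U A Ustar\<close>, with its natural domain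
  \<open>{f \<in> ell2 V. Ustar f \<in> dom A}\<close>.\<close>

definition conjugate_op ::
    "'v set \<Rightarrow> (('v \<Rightarrow> complex) \<Rightarrow> ('v \<Rightarrow> complex)) \<Rightarrow> 'v operator \<Rightarrow>
     (('v \<Rightarrow> complex) \<Rightarrow> ('v \<Rightarrow> complex)) \<Rightarrow> 'v operator" where
  "conjugate_op V U A Ustar = (\<lambda>f. if f \<in> ell2 V then map_option U (A (Ustar f)) else None)"

definition unitarily_equivalent :: "'v set \<Rightarrow> 'v operator \<Rightarrow> 'v operator \<Rightarrow> bool" where
  "unitarily_equivalent V A B \<longleftrightarrow>
     (\<exists>U Ustar. unitary_on V U \<and> adjoint_on V U Ustar \<and> B = conjugate_op V U A Ustar)"

section \<open>Weighted shifts\<close>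

definition shift_map ::
    "'v set \<Rightarrow> ('v \<Rightarrow> 'v) \<Rightarrow> ('v \<Rightarrow> complex) \<Rightarrow> ('v \<Rightarrow> complex) \<Rightarrow> ('v \<Rightarrow> complex)" where
  "shift_map V p lam f = (\<lambda>v. if v \<in> V then lam v * f (p v) else 0)"

definition weighted_shift ::
    "'v set \<Rightarrow> ('v \<Rightarrow> 'v) \<Rightarrow> ('v \<Rightarrow> complex) \<Rightarrow> 'v operator" where
  "weighted_shift V p lam =
     (\<lambda>f. if f \<in> ell2 V \<and> shift_map V p lam f \<in> ell2 V then Some (shift_map V p lam f) else None)"

lemma dom_weighted_shift:
  "dom (weighted_shift V p lam) = {f \<in> ell2 V. shift_map V p lam f \<in> ell2 V}"
  by (auto simp: weighted_shift_def dom_def)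

lemma dom_conjugate_op:
  "dom (conjugate_op V U A Ustar) = {f \<in> ell2 V. Ustar f \<in> dom A}"
  by (auto simp: conjugate_op_def dom_def)

end

theory Submission
  imports Defs
begin

text \<open>
  Multiplication by a unimodular \<open>b\<close> conjugates the two shifts if
  \<open>b v * lam v * cnj (b (p v)) = \<bar>lam v\<bar>\<close> on \<open>V\<close>. It suffices that \<open>b v = s v * b (p v)\<close>, where
  \<open>s v\<close> is the conjugate phase of \<open>lam v\<close>, or \<open>1\<close> if \<open>lam v = 0\<close>.
  A tree need not have a root, so \<open>b\<close> is normalised at an arbitrarily chosen
  vertex of each tree: if the paths from \<open>v\<close> and from the chosen vertex \<open>r\<close> meet, then \<open>b v\<close> is the
  quotient of the products of \<open>s\<close> along both paths. As \<open>s\<close> is \<open>1\<close> at the roots, the only vertices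
  where a path can stay, the quotient does not depend on the meeting point.
\<close>

text \<open>The factor at the endpoint \<open>(p ^^ n) v\<close> is left out, so that the products
  over consecutive path segments multiply.\<close>

definition path_prod :: "('v \<Rightarrow> 'v) \<Rightarrow> ('v \<Rightarrow> 'a::comm_monoid_mult) \<Rightarrow> nat \<Rightarrow> 'v \<Rightarrow> 'a" where
  "path_prod p s n v = (\<Prod>i<n. s ((p ^^ i) v))"

lemma path_prod_add: "path_prod p s (m + n) v = path_prod p s m v * path_prod p s n ((p ^^ m) v)"
proof (induction n)
  case (Suc n)
  have "(p ^^ (m + n)) v = (p ^^ n) ((p ^^ m) v)"
    by (metis add.commute comp_apply funpow_add)
  with Suc show ?case by (simp add: path_prod_def mult.assoc)
qed (simp add: path_prod_def)

lemma path_prod_Suc: "path_prod p s (Suc n) v = s v * path_prod p s n (p v)"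
  using path_prod_add[of p s 1 n v] by (simp add: path_prod_def)

lemma path_prod_fixpoint:
  assumes "p v = v" "s v = 1"
  shows "path_prod p s n v = 1"
  by (induction n) (simp_all add: path_prod_Suc assms, simp add: path_prod_def)

lemma norm_path_prod:
  fixes s :: "'v \<Rightarrow> 'a::{real_normed_div_algebra,comm_ring_1}"
  assumes "\<And>v. norm (s v) = 1"
  shows "norm (path_prod p s n v) = 1"
  by (simp add: path_prod_def assms flip: prod_norm)

lemma funpow_in_forest:
  assumes "directed_forest V p" "v \<in> V"
  shows "(p ^^ n) v \<in> V"
  using assms by (induction n) (auto simp: directed_forest_def)

text \<open>If \<open>m < n\<close>, then \<open>(p ^^ m) v\<close> returns to itself after
  \<open>n - m\<close> steps, so it is a root by the forest axiom, and the additional factors of the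
  longer product are all \<open>1\<close>.\<close>

lemma path_prod_eq_if_same_end:
  assumes forest: "directed_forest V p" and "v \<in> V"
    and roots: "\<And>w. w \<in> forest_roots V p \<Longrightarrow> s w = 1"
    and ends: "(p ^^ m) v = (p ^^ n) v"
  shows "path_prod p s m v = path_prod p s n v"
  using ends
proof (induction m n rule: linorder_wlog)
  case (le m n)
  show ?case
  proof (cases "m = n")
    case False
    define w where "w = (p ^^ m) v"
    have w: "w \<in> V" unfolding w_def using forest \<open>v \<in> V\<close> by (rule funpow_in_forest)
    have n: "n = m + (n - m)" using le(1) by simp
    have "(p ^^ n) v = (p ^^ (n - m)) w"
      using fun_cong[OF funpow_add[of "n - m" m p], of v] le(1) by (simp add: w_def)
    then have "(p ^^ (n - m)) w = w" using le(2) by (metis w_def)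
    moreover have "n - m \<ge> 1" using le(1) False by simp
    ultimately have "p w = w" using forest w unfolding directed_forest_def by blast
    then have "path_prod p s (n - m) w = 1"
      using roots w by (intro path_prod_fixpoint) (auto simp: forest_roots_def)
    then show ?thesis by (subst n) (simp add: path_prod_add flip: w_def)
  qed simp
qed simp

text \<open>Going on for \<open>n'\<close> steps from the first meeting point and for
  \<open>n\<close> steps from the second leads to the same vertex, since both points lie on the path
  of \<open>r\<close>. The two extended paths from \<open>v\<close> therefore have equal products,
  and so do those from \<open>r\<close>.\<close>

lemma path_quotient_unique:
  fixes s :: "'v \<Rightarrow> 'a::field"
  assumes forest: "directed_forest V p" "v \<in> V"
    and roots: "\<And>w. w \<in> forest_roots V p \<Longrightarrow> s w = 1"
    and nz: "\<And>w. s w \<noteq> 0"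
    and meet: "(p ^^ m) v = (p ^^ n) r" "(p ^^ m') v = (p ^^ n') r"
  shows "path_prod p s m v / path_prod p s n r = path_prod p s m' v / path_prod p s n' r"
proof -
  let ?P = "path_prod p s"
  have nz': "?P k w \<noteq> 0" for k w by (simp add: path_prod_def nz)
  have "(p ^^ (n' + m)) v = (p ^^ n') ((p ^^ n) r)"
    by (simp only: funpow_add comp_apply meet)
  also have "\<dots> = (p ^^ n) ((p ^^ n') r)"
    using fun_cong[OF funpow_add[of n n' p], of r] fun_cong[OF funpow_add[of n' n p], of r]
    by (simp only: add.commute[of n'] comp_apply)
  also have "\<dots> = (p ^^ (n + m')) v"
    by (simp only: funpow_add comp_apply meet)
  finally have "(p ^^ (m + n')) v = (p ^^ (m' + n)) v"
    by (simp only: add.commute)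
  then have "?P (m + n') v = ?P (m' + n) v"
    by (intro path_prod_eq_if_same_end[OF forest roots])
  then have eq: "?P m v * ?P n' ((p ^^ n) r) = ?P m' v * ?P n ((p ^^ n') r)"
    by (simp only: path_prod_add meet)
  have "?P n r * ?P n' ((p ^^ n) r) = ?P n' r * ?P n ((p ^^ n') r)"
    by (metis add.commute path_prod_add)
  \<comment> \<open>The nonzero factor \<open>?P n ((p ^^ n') r)\<close> links the two equations and
    is then cancelled.\<close>
  then have "(?P m v * ?P n' r) * ?P n ((p ^^ n') r) = (?P m v * ?P n' ((p ^^ n) r)) * ?P n r"
    by (simp only: mult.assoc) (simp only: mult.commute)
  also have "\<dots> = (?P m' v * ?P n r) * ?P n ((p ^^ n') r)"
    by (simp only: eq mult_ac)
  finally have "?P m v * ?P n' r = ?P m' v * ?P n r"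
    using nz' by simp
  then show ?thesis using nz' by (simp add: frac_eq_eq)
qed

lemma ex_unimodular_potential:
  fixes s :: "'v \<Rightarrow> 'a::{real_normed_field}"
  assumes forest: "directed_forest V p"
    and roots: "\<And>w. w \<in> forest_roots V p \<Longrightarrow> s w = 1"
    and norm_s: "\<And>w. norm (s w) = 1"
  obtains b where "\<And>v. norm (b v) = 1" "\<And>v. v \<in> V \<Longrightarrow> b v = s v * b (p v)"
proof -
  have nz: "s w \<noteq> 0" for w using norm_s[of w] by auto
  define meet where "meet v r k \<longleftrightarrow> (p ^^ fst k) v = (p ^^ snd k) r" for v r and k :: "nat \<times> nat"
  \<comment> \<open>The choice depends on \<open>v\<close> only through the predicate, so once the
    predicates for \<open>v\<close> and \<open>p v\<close> are shown to coincide,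
    \<open>r (p v)\<close> and \<open>r v\<close> are the same vertex.\<close>
  define r where "r v = (SOME r. \<exists>k. meet v r k)" for v
  define k where "k v = (SOME k. meet v (r v) k)" for v
  define b where
    "b v = path_prod p s (fst (k v)) v / path_prod p s (snd (k v)) (r v)" for v
  have "\<exists>k. meet v (r v) k" for v
    unfolding r_def by (rule someI[of _ v]) (auto simp: meet_def intro: exI[of _ "(0, 0)"])
  then have k: "meet v (r v) (k v)" for v unfolding k_def by (rule someI_ex)
  have "(\<exists>k. meet (p v) x k) = (\<exists>k. meet v x k)" for v x
  proof
    assume "\<exists>k. meet (p v) x k"
    then obtain i j where "(p ^^ i) (p v) = (p ^^ j) x" by (auto simp: meet_def)
    then have "meet v x (Suc i, j)" by (simp add: meet_def funpow_swap1)
    then show "\<exists>k. meet v x k" ..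
  next
    assume "\<exists>k. meet v x k"
    then obtain i j where "(p ^^ i) v = (p ^^ j) x" by (auto simp: meet_def)
    \<comment> \<open>Lengthening the path of \<open>x\<close> instead of shortening that of
      \<open>v\<close> also covers \<open>i = 0\<close>.\<close>
    then have "meet (p v) x (i, Suc j)" by (simp add: meet_def funpow_swap1[symmetric])
    then show "\<exists>k. meet (p v) x k" ..
  qed
  then have r: "r (p v) = r v" for v by (simp add: r_def)
  show thesis
  proof
    show "norm (b v) = 1" for v
      by (simp add: b_def norm_divide norm_path_prod norm_s)
    fix v assume "v \<in> V"
    \<comment> \<open>The meeting chosen for \<open>p v\<close> is also one for \<open>v\<close>,
      with one more step at the start. By uniqueness it may replace \<open>k v\<close>, and the
      additional step contributes the factor \<open>s v\<close>.\<close>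
    have "(p ^^ Suc (fst (k (p v)))) v = (p ^^ snd (k (p v))) (r v)"
      using k[of "p v"] by (simp add: meet_def r funpow_swap1)
    with k[of v] have "b v =
        path_prod p s (Suc (fst (k (p v)))) v / path_prod p s (snd (k (p v))) (r v)"
      unfolding b_def meet_def
      by (intro path_quotient_unique[OF forest \<open>v \<in> V\<close> roots nz])
    then show "b v = s v * b (p v)"
      by (simp add: b_def r path_prod_Suc)
  qed
qed

text \<open>Neither the moduli nor the zeros of the function change.\<close>

lemma ell2_mult_unimodular_iff:
  assumes "\<And>v. cmod (b v) = 1"
  shows "(\<lambda>v. b v * f v) \<in> ell2 V \<longleftrightarrow> f \<in> ell2 V"
proof -
  have "b v \<noteq> 0" for v using assms[of v] by auto
  then show ?thesis by (simp add: ell2_def norm_mult assms)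
qed

lemma unitary_on_mult_unimodular:
  assumes b: "\<And>v. cmod (b v) = 1"
  shows "unitary_on V (\<lambda>f v. b v * f v)"
proof -
  have inv: "b v * cnj (b v) = 1" for v
    using complex_norm_square[of "b v"] b[of v] by simp
  have inv': "b v * (cnj (b v) * z) = z" "cnj (b v) * (b v * z) = z" for v z
    using inv[of v] by (metis mult.assoc mult.commute mult_1)+
  have "bij_betw (\<lambda>f v. b v * f v) (ell2 V) (ell2 V)"
    by (rule bij_betw_byWitness[where f' = "\<lambda>f v. cnj (b v) * f v"])
      (auto simp: inv' ell2_mult_unimodular_iff b)
  moreover have "b v * f v * cnj (b v * g v) = f v * cnj (g v)" for f g v
    unfolding complex_cnj_mult using inv[of v] by (metis mult.assoc mult.commute mult_1)
  then have "ell2_inner V (\<lambda>v. b v * f v) (\<lambda>v. b v * g v) = ell2_inner V f g" for f g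
    unfolding ell2_inner_def by presburger
  ultimately show ?thesis
    by (simp add: unitary_on_def distrib_left mult.left_commute)
qed

lemma adjoint_on_mult_unimodular:
  assumes "\<And>v. cmod (b v) = 1"
  shows "adjoint_on V (\<lambda>f v. b v * f v) (\<lambda>f v. cnj (b v) * f v)"
proof -
  have "(\<lambda>v. cnj (b v) * f v) \<in> ell2 V" if "f \<in> ell2 V" for f
    using that by (simp add: ell2_mult_unimodular_iff assms)
  then show ?thesis by (auto simp: adjoint_on_def ell2_inner_def mult_ac)
qed

theorem theorem3p7:
  fixes V :: "'v set" and p :: "'v \<Rightarrow> 'v" and lam :: "'v \<Rightarrow> complex"
  assumes "directed_forest V p"
    and "weight_system V p lam"
  shows "unitarily_equivalent V (weighted_shift V p lam)
           (weighted_shift V p (\<lambda>v. complex_of_real (cmod (lam v))))"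
proof -
  \<comment> \<open>The value \<open>1\<close> at zero weights keeps \<open>s\<close> unimodular
    everywhere and makes it \<open>1\<close> at the roots.\<close>
  define s where "s v = (if lam v = 0 then 1 else cnj (sgn (lam v)))" for v
  have "s v = 1" if "v \<in> forest_roots V p" for v
    using assms(2) that by (simp add: s_def weight_system_def)
  moreover have "cmod (s v) = 1" for v by (simp add: s_def norm_sgn)
  ultimately obtain b where b: "\<And>v. cmod (b v) = 1"
    and b_step: "\<And>v. v \<in> V \<Longrightarrow> b v = s v * b (p v)"
    using ex_unimodular_potential[OF assms(1), of s] by blast
  let ?U = "\<lambda>f v. b v * f v" and ?Ustar = "\<lambda>f v. cnj (b v) * f v"
  let ?abs = "\<lambda>v. complex_of_real (cmod (lam v))"
  have s_lam: "s v * lam v = ?abs v" for v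
  proof (cases "lam v = 0")
    case False
    have "sgn (lam v) * cmod (lam v) = lam v" by (simp add: sgn_eq)
    then have "s v * lam v = (sgn (lam v) * cnj (sgn (lam v))) * cmod (lam v)"
      using False by (metis mult.assoc mult.commute s_def)
    also have "sgn (lam v) * cnj (sgn (lam v)) = 1"
      using complex_norm_square[of "sgn (lam v)"] False by (simp add: norm_sgn)
    finally show ?thesis by simp
  qed simp
  have phase: "b v * (lam v * cnj (b (p v))) = ?abs v" if "v \<in> V" for v
  proof -
    have "b v * (lam v * cnj (b (p v))) = (s v * lam v) * (b (p v) * cnj (b (p v)))"
      using b_step[OF that] by simp
    moreover have "b (p v) * cnj (b (p v)) = 1"
      using complex_norm_square[of "b (p v)"] b[of "p v"] by simp
    ultimately show ?thesis by (simp add: s_lam)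
  qed
  \<comment> \<open>This identity holds for arbitrary functions, so it also serves to compare the
    domains.\<close>
  have shift: "?U (shift_map V p lam (?Ustar f)) = shift_map V p ?abs f" for f
    by (rule ext) (simp add: shift_map_def mult.assoc flip: phase)
  have "weighted_shift V p ?abs = conjugate_op V ?U (weighted_shift V p lam) ?Ustar"
  proof
    fix f
    have "shift_map V p lam (?Ustar f) \<in> ell2 V \<longleftrightarrow> shift_map V p ?abs f \<in> ell2 V"
      using ell2_mult_unimodular_iff[of b "shift_map V p lam (?Ustar f)" V, OF b]
      by (simp only: shift)
    moreover have "?Ustar f \<in> ell2 V \<longleftrightarrow> f \<in> ell2 V"
      by (rule ell2_mult_unimodular_iff) (simp add: b)
    ultimately show "weighted_shift V p ?abs f =
        conjugate_op V ?U (weighted_shift V p lam) ?Ustar f"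
      by (simp add: weighted_shift_def conjugate_op_def shift)
  qed
  then show ?thesis
    unfolding unitarily_equivalent_def
    using unitary_on_mult_unimodular[of b, OF b] adjoint_on_mult_unimodular[of b, OF b] by blast
qed

end
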